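(* Let $A\in\mathbb{R}^{m\times n}$ be a nonzero matrix and let $b\in\mathbb{R}^m$ be arbitrary (the linear system $Ax=b$ may be consistent or inconsistent, and $A$ may have any rank). Let $\{x^k\}_{k=0}^{\infty}$ be the random sequence generated by the randomized Kaczmarz method with adaptive stepsizes (RKAS) applied to $Ax=b$ with $x^0=0$. Then for every $k\ge 0$, $$\mathbb{E}\left[\left\|x^k-A^\dagger b\right\|^2_2\right]\leq \sigma_{\min}^{-2}(A)\left(1-\frac{\sigma_{\min}^4(A)}{\|A\|_2^2\,\|A\|_F^2}\right)^k\left\|Ax^0-AA^\dagger b\right\|^2_2.$$
   Context: Notation: $A_{i,:}$ is the $i$-th row of $A$ (a row vector), $A^\top$ the transpose, $A^\dagger$ the Moore-Penrose pseudoinverse, $\|A\|_2$ the spectral norm, $\|A\|_F$ the Frobenius norm, $\sigma_{\min}(A)>0$ the smallest nonzero singular value of $A$, and $\|\cdot\|_2$ and $\langle\cdot,\cdot\rangle$ the Euclidean norm and inner product on vectors. The vector $A^\dagger b$ is the unique minimum Euclidean norm least-squares solution of $Ax=b$. RKAS algorithm: start with $x^0=0\in\mathbb{R}^n$ and $r^0=Ax^0-b=-b$. For $k=0,1,2,\dots$: (1) select a random index $i_k\in\{1,\dots,m\}$, independently of the previous selections, with $\Pr(i_k=i)=\|A_{i,:}\|_2^2/\|A\|_F^2$ (so zero rows are selected with probability zero); (2) compute $\alpha_k=\dfrac{\langle AA_{i_k,:}^\top,\,r^k\rangle}{\|AA_{i_k,:}^\top\|_2^2}$; (3) update $x^{k+1}=x^k-\alpha_kA_{i_k,:}^\top$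 and $r^{k+1}=r^k-\alpha_kAA_{i_k,:}^\top$. The algorithm is run without a stopping rule, and the expectation is over the random choices $i_0,i_1,\dots$. *)

theory Defs
  imports "HOL-Probability.Probability"
begin

definition frobenius_norm :: "real^'n^'m \<Rightarrow> real" where
  "frobenius_norm A = sqrt (\<Sum>i\<in>UNIV. \<Sum>j\<in>UNIV. (A $ i $ j)\<^sup>2)"

definition spectral_norm :: "real^'n^'m \<Rightarrow> real" where
  "spectral_norm A = onorm ((*v) A)"

(* For m < n this counts 0 as a singular value even if A has full row rank;
   the nonzero singular values do not depend on that convention. *)
definition singular_value :: "real^'n^'m \<Rightarrow> real \<Rightarrow> bool" where
  "singular_value A s \<longleftrightarrow>
     s \<ge> 0 \<and> (\<exists>v. v \<noteq> 0 \<and> (transpose A ** A) *v v = s\<^sup>2 *\<^sub>R v)"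

(* Meaningful for A \<noteq> 0 only: otherwise the set is empty. *)
definition sigma_min :: "real^'n^'m \<Rightarrow> real" where
  "sigma_min A = Min {s. singular_value A s \<and> s \<noteq> 0}"

(* The four Penrose conditions. *)
definition is_pseudoinverse :: "real^'n^'m \<Rightarrow> real^'m^'n \<Rightarrow> bool" where
  "is_pseudoinverse A X \<longleftrightarrow>
     A ** X ** A = A \<and> X ** A ** X = X \<and>
     transpose (A ** X) = A ** X \<and> transpose (X ** A) = X ** A"

definition pseudoinverse :: "real^'n^'m \<Rightarrow> real^'m^'n" where
  "pseudoinverse A = (THE X. is_pseudoinverse A X)"

(* If row i of A is zero, HOL's division by zero makes this 0; such rows are
   selected with probability zero. *)
definition rkas_stepsize :: "real^'n^'m \<Rightarrow> 'm \<Rightarrow> real^'m \<Rightarrow> real" where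
  "rkas_stepsize A i r = ((A *v row i A) \<bullet> r) / (norm (A *v row i A))\<^sup>2"

(* The pair (x^k, r^k) when the selected indices are s 0, s 1, ... *)
primrec rkas_state :: "real^'n^'m \<Rightarrow> real^'m \<Rightarrow> (nat \<Rightarrow> 'm) \<Rightarrow> nat \<Rightarrow> (real^'n) \<times> (real^'m)" where
  "rkas_state A b s 0 = (0, A *v 0 - b)"
| "rkas_state A b s (Suc k) =
     (let (x, r) = rkas_state A b s k; \<alpha> = rkas_stepsize A (s k) r
      in (x - \<alpha> *\<^sub>R row (s k) A, r - \<alpha> *\<^sub>R (A *v row (s k) A)))"

definition rkas_iterate :: "real^'n^'m \<Rightarrow> real^'m \<Rightarrow> (nat \<Rightarrow> 'm) \<Rightarrow> nat \<Rightarrow> real^'n" where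
  "rkas_iterate A b s k = fst (rkas_state A b s k)"

end

theory Submission imports Defs begin

text \<open>
  Write y for the projected residual \<open>A x - A A\<^sup>\<dagger> b\<close>. The component of the true residual orthogonal to
  the column space does not influence the stepsize, so a step with row a replaces y by its orthogonal
  projection along A a. Since the norm of A a is at most \<open>spectral_norm A * norm a\<close>, averaging the
  resulting decrease over the rows gives at least a multiple of the squared norm of \<open>A A\<^sup>T y\<close>. The
  bound \<open>norm (A v) \<ge> sigma_min A * norm v\<close> on the row space, applied to \<open>A\<^sup>T y\<close>, and its dual on
  the column space, applied to y, turn this into a contraction of the expected squared norm of y.
  The error \<open>x - A\<^sup>\<dagger> b\<close> stays in the row space, so the first bound passes from y to the error.
\<close>

section \<open>Adjoints, orthogonal projections and the Moore-Penrose pseudoinverse\<close>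

lemma inner_matrix_vector_mult_left:
  fixes A :: "real^'n^'m"
  shows "(A *v x) \<bullet> y = x \<bullet> (transpose A *v y)"
  by (metis dot_lmul_matrix inner_commute vector_transpose_matrix transpose_transpose)

text \<open>Expansion along an orthonormal basis of \<open>S\<close> gives such a map; its
  self-adjointness is what later yields the two symmetric Penrose conditions.\<close>

lemma linear_orthogonal_projection_exists:
  fixes S :: "'a::euclidean_space set"
  assumes "subspace S"
  obtains P where "linear P" "\<And>x. P x \<in> S" "\<And>x. x \<in> S \<Longrightarrow> P x = x"
    "\<And>x y. P x \<bullet> y = x \<bullet> P y"
proof -
  obtain B where B: "B \<subseteq> S" "pairwise orthogonal B" "\<And>x. x \<in> B \<Longrightarrow> norm x = 1"
      "independent B" "span B = S"
    using orthonormal_basis_subspace[OF assms] by metis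
  have fin: "finite B" using B(4) by (rule independent_imp_finite)
  define P where "P x = (\<Sum>b\<in>B. (b \<bullet> x) *\<^sub>R b)" for x
  have lin: "linear P"
    unfolding P_def
    by (intro linearI)
       (simp_all add: inner_add_right scaleR_add_left sum.distrib scaleR_sum_right)
  have "P b = b" if "b \<in> B" for b
  proof -
    have "P b = (\<Sum>a\<in>B. if a = b then b else 0)"
      unfolding P_def
    proof (rule sum.cong[OF refl])
      fix a assume "a \<in> B"
      then show "(a \<bullet> b) *\<^sub>R a = (if a = b then b else 0)"
        using B(2,3) that by (auto simp: pairwise_def orthogonal_def norm_eq_1)
    qed
    then show ?thesis using fin that by simp
  qed
  then have "P x = x" if "x \<in> S" for x
    using linear_eq_on[OF lin linear_id, of x B] that B(5) by auto
  moreover have "P x \<in> S" for x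
    unfolding P_def using B(1) assms
    by (intro subspace_sum subspace_scale) auto
  moreover have "P x \<bullet> y = x \<bullet> P y" for x y
    unfolding P_def by (simp add: inner_sum_left inner_sum_right inner_commute mult.commute)
  ultimately show ?thesis using lin that by blast
qed

lemma transpose_eq_self_if_self_adjoint:
  fixes Q :: "real^'n^'n"
  assumes "\<And>x y. (Q *v x) \<bullet> y = x \<bullet> (Q *v y)"
  shows "transpose Q = Q"
proof -
  have "x \<bullet> (transpose Q *v y) = x \<bullet> (Q *v y)" for x y
    using assms by (simp add: inner_matrix_vector_mult_left)
  then have "transpose Q *v y = Q *v y" for y
    by (metis vector_eq_ldot)
  then show ?thesis by (simp add: matrix_eq)
qed

text \<open>Pairing the hypothesis with \<open>z\<close> gives the squared norm of
  \<open>transpose A *v z\<close>. Thus the kernel of \<open>A\<close> meets the row space only in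
  0.\<close>

lemma transpose_mult_eq_0_imp:
  fixes A :: "real^'n^'m"
  assumes "A *v (transpose A *v z) = 0"
  shows "transpose A *v z = 0"
  using assms inner_matrix_vector_mult_left[of A "transpose A *v z" z]
  by simp

lemma subspace_range_matrix: "subspace (range ((*v) (A :: real^'n^'m)))"
  by (intro linear_subspace_image) auto

text \<open>The witness projects orthogonally onto the column space and then inverts
  \<open>A\<close> on the row space, where it is injective. Both products with \<open>A\<close> are
  then orthogonal projections: \<open>A ** X\<close> acts as \<open>Q\<close> and
  \<open>X ** A\<close> as \<open>P\<close>.\<close>

lemma is_pseudoinverse_exists:
  fixes A :: "real^'n^'m"
  shows "\<exists>X. is_pseudoinverse A X"
proof -
  define S where "S = range ((*v) (transpose A))"
  define R where "R = range ((*v) A)"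
  have subS: "subspace S" unfolding S_def by (rule subspace_range_matrix)
  obtain P where P: "linear P" "\<And>x. P x \<in> S" "\<And>x. x \<in> S \<Longrightarrow> P x = x"
    "\<And>x y. P x \<bullet> y = x \<bullet> P y"
    using linear_orthogonal_projection_exists[OF subS] by metis
  obtain Q where Q: "linear Q" "\<And>x. Q x \<in> R" "\<And>x. x \<in> R \<Longrightarrow> Q x = x"
    "\<And>x y. Q x \<bullet> y = x \<bullet> Q y"
    using linear_orthogonal_projection_exists[of R] subspace_range_matrix unfolding R_def by metis
  \<comment> \<open>What \<open>P\<close> removes is orthogonal to the row space, hence killed by
    \<open>A\<close>: tested against \<open>y\<close>, the projection moves to
    \<open>transpose A *v y\<close>, which it fixes.\<close>
  have AP: "A *v P w = A *v w" for w
  proof -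
    have "y \<bullet> (A *v P w) = y \<bullet> (A *v w)" for y
    proof -
      have "(A *v P w) \<bullet> y = w \<bullet> P (transpose A *v y)"
        by (simp add: inner_matrix_vector_mult_left P(4))
      also have "\<dots> = (A *v w) \<bullet> y"
        by (simp add: P(3) S_def inner_matrix_vector_mult_left)
      finally show ?thesis by (simp add: inner_commute)
    qed
    then show ?thesis by (metis vector_eq_ldot)
  qed
  have inj: "inj_on ((*v) A) S"
  proof (rule inj_onI)
    fix x y assume x: "x \<in> S" and y: "y \<in> S" and eq: "A *v x = A *v y"
    then have "x - y \<in> S" using subS subspace_diff by blast
    then obtain z where z: "x - y = transpose A *v z" unfolding S_def by auto
    have "A *v (x - y) = 0" using eq by (simp add: matrix_vector_mult_diff_distrib)
    then show "x = y" using transpose_mult_eq_0_imp[of A z] z by simp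
  qed
  obtain g where g: "range g \<subseteq> S" "linear g" "\<And>v. v \<in> S \<Longrightarrow> g (A *v v) = v"
    using linear_exists_left_inverse_on[OF _ subS inj] by auto
  define X where "X = matrix (g \<circ> Q)"
  have X: "X *v y = g (Q y)" for y
    unfolding X_def using matrix_works[of "g \<circ> Q" y] linear_compose[OF Q(1) g(2)] by simp
  have AX: "A *v (X *v y) = Q y" for y
  proof -
    obtain w where "Q y = A *v w" using Q(2)[of y] unfolding R_def by auto
    then show ?thesis using g(3)[OF P(2)[of w]] by (simp add: X AP)
  qed
  have XA: "X *v (A *v w) = P w" for w
  proof -
    have "Q (A *v w) = A *v P w" by (simp add: Q(3) R_def AP)
    then show ?thesis by (simp add: X g(3) P(2))
  qed
  have "A ** X ** A = A"
    by (simp add: matrix_eq matrix_vector_mul_assoc[symmetric] AX Q(3) R_def)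
  \<comment> \<open>The range of \<open>X\<close> lies in the range of \<open>g\<close>, hence in
    \<open>S\<close>, where \<open>P\<close> is the identity.\<close>
  moreover have "X ** A ** X = X"
    using g(1) by (auto simp add: matrix_eq matrix_vector_mul_assoc[symmetric] XA)
      (simp add: X P(3) range_subsetD)
  moreover have "transpose (A ** X) = A ** X"
    by (rule transpose_eq_self_if_self_adjoint) (simp add: matrix_vector_mul_assoc[symmetric] AX Q(4))
  moreover have "transpose (X ** A) = X ** A"
    by (rule transpose_eq_self_if_self_adjoint) (simp add: matrix_vector_mul_assoc[symmetric] XA P(4))
  ultimately show ?thesis unfolding is_pseudoinverse_def by blast
qed

text \<open>Symmetry allows the factors to be swapped by transposing, so the products with
  \<open>A\<close> agree on either side; then \<open>X\<close> = \<open>X ** A ** X\<close> =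
  \<open>Y ** A ** Y\<close> = \<open>Y\<close>.\<close>

lemma is_pseudoinverse_unique:
  fixes A :: "real^'n^'m"
  assumes X: "is_pseudoinverse A X" and Y: "is_pseudoinverse A Y"
  shows "X = Y"
proof -
  have "A ** X = (A ** Y) ** (A ** X)"
    using Y unfolding is_pseudoinverse_def by (metis matrix_mul_assoc)
  also have "\<dots> = transpose ((A ** X) ** (A ** Y))"
    using X Y unfolding is_pseudoinverse_def by (metis matrix_transpose_mul)
  also have "\<dots> = A ** Y"
    using X Y unfolding is_pseudoinverse_def by (metis matrix_mul_assoc)
  finally have AX: "A ** X = A ** Y" .
  have "X ** A = (X ** A) ** (Y ** A)"
    using Y unfolding is_pseudoinverse_def by (metis matrix_mul_assoc)
  also have "\<dots> = transpose ((Y ** A) ** (X ** A))"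
    using X Y unfolding is_pseudoinverse_def by (metis matrix_transpose_mul)
  also have "\<dots> = Y ** A"
    using X Y unfolding is_pseudoinverse_def by (metis matrix_mul_assoc)
  finally have XA: "X ** A = Y ** A" .
  show ?thesis
    using X Y AX XA unfolding is_pseudoinverse_def by (metis matrix_mul_assoc)
qed

lemma is_pseudoinverse_pseudoinverse: "is_pseudoinverse A (pseudoinverse A)"
  unfolding pseudoinverse_def
  by (rule theI') (use is_pseudoinverse_exists is_pseudoinverse_unique in blast)

text \<open>Places the limit point in the row space, where the iterates live too, so that the error
  can be bounded through its image under \<open>A\<close>.\<close>

lemma pseudoinverse_in_row_space:
  fixes A :: "real^'n^'m"
  shows "pseudoinverse A *v b \<in> range ((*v) (transpose A))"
proof -
  let ?X = "pseudoinverse A"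
  have "?X = ?X ** A ** ?X" "transpose (?X ** A) = ?X ** A"
    using is_pseudoinverse_pseudoinverse[of A] unfolding is_pseudoinverse_def by auto
  then have "?X = transpose A ** (transpose ?X ** ?X)"
    by (metis matrix_transpose_mul matrix_mul_assoc)
  then have "?X *v b = transpose A *v ((transpose ?X ** ?X) *v b)"
    by (metis matrix_vector_mul_assoc)
  then show ?thesis by blast
qed

text \<open>The normal equations of least squares, from \<open>A ** pseudoinverse A\<close> being
  symmetric and fixing the column space.\<close>

lemma pseudoinverse_residual_orthogonal:
  fixes A :: "real^'n^'m"
  shows "(A *v v) \<bullet> (A *v (pseudoinverse A *v b) - b) = 0"
proof -
  let ?X = "pseudoinverse A"
  have eq: "A ** ?X ** A = A" "transpose (A ** ?X) = A ** ?X"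
    using is_pseudoinverse_pseudoinverse[of A] unfolding is_pseudoinverse_def by auto
  have "(A *v v) \<bullet> (A *v (?X *v b)) = ((A ** ?X) *v (A *v v)) \<bullet> b"
    using inner_matrix_vector_mult_left[of "A ** ?X" "A *v v" b]
    by (simp add: eq(2) matrix_vector_mul_assoc)
  also have "(A ** ?X) *v (A *v v) = A *v v"
    by (metis matrix_vector_mul_assoc eq(1))
  finally show ?thesis by (simp add: inner_diff_right)
qed

section \<open>Smallest nonzero singular value and its lower bounds on the row and column
  spaces\<close>

text \<open>Eigenvectors of a symmetric matrix for distinct eigenvalues are orthogonal, hence
  independent, so only finitely many fit. This makes the \<open>Min\<close> in
  \<open>sigma_min\<close> a genuine minimum.\<close>

lemma finite_singular_values:
  fixes A :: "real^'n^'m"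
  shows "finite {s. singular_value A s}"
proof -
  let ?E = "{s. singular_value A s}"
  let ?B = "transpose A ** A"
  obtain e where e: "\<And>s. s \<in> ?E \<Longrightarrow> e s \<noteq> 0 \<and> ?B *v e s = s\<^sup>2 *\<^sub>R e s"
    using that[of "\<lambda>s. SOME v. v \<noteq> 0 \<and> ?B *v v = s\<^sup>2 *\<^sub>R v"]
    unfolding singular_value_def mem_Collect_eq by (metis (mono_tags, lifting) someI_ex)
  have sym: "(?B *v x) \<bullet> y = x \<bullet> (?B *v y)" for x y
    by (simp add: inner_matrix_vector_mult_left matrix_transpose_mul)
  have orth: "e s \<bullet> e t = 0" if "s \<in> ?E" "t \<in> ?E" "s \<noteq> t" for s t
  proof -
    have "s\<^sup>2 * (e s \<bullet> e t) = t\<^sup>2 * (e s \<bullet> e t)"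
      using sym[of "e s" "e t"] e[OF that(1)] e[OF that(2)] by simp
    \<comment> \<open>Singular values are nonnegative, so squaring keeps them distinct.\<close>
    moreover have "s\<^sup>2 \<noteq> t\<^sup>2"
      using that by (auto simp: singular_value_def power2_eq_iff)
    ultimately show ?thesis by simp
  qed
  have "inj_on e ?E"
  proof (rule inj_onI, rule ccontr)
    fix s t assume "s \<in> ?E" "t \<in> ?E" "e s = e t" "s \<noteq> t"
    then show False using orth[of s t] e[of s] by simp
  qed
  moreover have "pairwise orthogonal (e ` ?E)"
    unfolding pairwise_def orthogonal_def using orth by blast
  then have "independent (e ` ?E)"
    by (rule pairwise_orthogonal_independent) (use e in force)
  then have "finite (e ` ?E)" by (rule independent_imp_finite)
  ultimately show ?thesis by (metis finite_imageD)
qed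

lemma row_space_ne_0:
  fixes A :: "real^'n^'m"
  assumes "A \<noteq> 0"
  obtains z where "transpose A *v z \<noteq> 0"
proof -
  have "transpose A \<noteq> 0" using assms by (auto simp: vec_eq_iff transpose_def)
  then show ?thesis using that by (metis matrix_eq matrix_vector_mult_0)
qed

text \<open>Variational characterization: compactness yields a minimizer on the unit sphere of the
  row space, and stationarity makes it an eigenvector. Its value is therefore a singular value,
  nonzero because \<open>A\<close> is injective on the row space.\<close>

lemma row_space_minimizer:
  fixes A :: "real^'n^'m"
  assumes "A \<noteq> 0"
  obtains u where "u \<in> range ((*v) (transpose A))" "norm u = 1" "A *v u \<noteq> 0"
    "(transpose A ** A) *v u = (norm (A *v u))\<^sup>2 *\<^sub>R u"
    "\<And>v. v \<in> range ((*v) (transpose A)) \<Longrightarrow> norm (A *v u) * norm v \<le> norm (A *v v)"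
proof -
  define S where "S = range ((*v) (transpose A))"
  have subS: "subspace S" unfolding S_def by (rule subspace_range_matrix)
  have "compact (S \<inter> sphere 0 1)"
    by (intro closed_Int_compact closed_subspace subS compact_sphere)
  moreover have "S \<inter> sphere 0 1 \<noteq> {}"
  proof -
    obtain z where "transpose A *v z \<noteq> 0" using row_space_ne_0[OF assms] .
    then have "(transpose A *v z) /\<^sub>R norm (transpose A *v z) \<in> S \<inter> sphere 0 1"
      using subspace_scale[OF subS] unfolding S_def by auto
    then show ?thesis by blast
  qed
  moreover have "continuous_on (S \<inter> sphere 0 1) (\<lambda>v. norm (A *v v))"
    by (intro continuous_intros matrix_vector_mult_linear_continuous_on)
  ultimately obtain u where u: "u \<in> S" "norm u = 1"
    and min1: "\<And>v. v \<in> S \<Longrightarrow> norm v = 1 \<Longrightarrow> norm (A *v u) \<le> norm (A *v v)"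
    using continuous_attains_inf[of "S \<inter> sphere 0 1" "\<lambda>v. norm (A *v v)"]
    by (metis IntD1 IntD2 IntI mem_sphere_0)
  have min: "norm (A *v u) * norm v \<le> norm (A *v v)" if "v \<in> S" for v
  proof (cases "v = 0")
    case False
    have "norm (A *v u) \<le> norm (A *v (v /\<^sub>R norm v))"
      using False that subS by (intro min1) (auto intro: subspace_scale)
    also have "\<dots> = norm (A *v v) / norm v"
      by (simp add: matrix_vector_mult_scaleR divide_inverse mult.commute)
    finally show ?thesis using False by (simp add: field_simps)
  qed auto
  define \<mu> where "\<mu> = (norm (A *v u))\<^sup>2"
  define g where "g = (transpose A ** A) *v u - \<mu> *\<^sub>R u"
  have gS: "g \<in> S"
  proof -
    have "(transpose A ** A) *v u \<in> S" by (simp add: S_def matrix_vector_mul_assoc[symmetric])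
    then show ?thesis unfolding g_def using u(1) subS by (intro subspace_diff subspace_scale)
  qed
  \<comment> \<open>The second-order coefficient of the variation below.\<close>
  define a where "a = (norm (A *v g))\<^sup>2 - \<mu> * (norm g)\<^sup>2"
  \<comment> \<open>First variation at u in the direction of the residual g, which itself lies in the row space.\<close>
  have var: "0 \<le> t * (2 * (norm g)\<^sup>2 + t * a)" for t :: real
  proof -
    have "u + t *\<^sub>R g \<in> S" using u(1) gS subS by (intro subspace_add subspace_scale)
    then have "(norm (A *v u) * norm (u + t *\<^sub>R g))\<^sup>2 \<le> (norm (A *v (u + t *\<^sub>R g)))\<^sup>2"
      by (intro power_mono min) auto
    then have "\<mu> * (norm (u + t *\<^sub>R g))\<^sup>2 \<le> (norm (A *v u + t *\<^sub>R (A *v g)))\<^sup>2"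
      by (simp add: \<mu>_def power_mult_distrib matrix_vector_right_distrib matrix_vector_mult_scaleR)
    moreover have "(norm (u + t *\<^sub>R g))\<^sup>2 = 1 + 2 * t * (u \<bullet> g) + t\<^sup>2 * (norm g)\<^sup>2"
      using u(2) unfolding power2_norm_eq_inner norm_eq_1
      by (simp add: inner_add_left inner_add_right inner_commute power2_eq_square algebra_simps)
    moreover have "(norm (A *v u + t *\<^sub>R (A *v g)))\<^sup>2
        = \<mu> + 2 * t * ((A *v u) \<bullet> (A *v g)) + t\<^sup>2 * (norm (A *v g))\<^sup>2"
      unfolding \<mu>_def power2_norm_eq_inner
      by (simp add: inner_add_left inner_add_right inner_commute power2_eq_square algebra_simps)
    \<comment> \<open>Moving \<open>A\<close> across the inner product turns the first-order
      coefficient into \<open>g \<bullet> g\<close>.\<close>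
    moreover have "(A *v u) \<bullet> (A *v g) - \<mu> * (u \<bullet> g) = (norm g)\<^sup>2"
    proof -
      have "(A *v u) \<bullet> (A *v g) = g \<bullet> ((transpose A ** A) *v u)"
        by (metis inner_commute inner_matrix_vector_mult_left matrix_vector_mul_assoc)
      then show ?thesis
        by (simp add: g_def power2_norm_eq_inner inner_diff_left inner_diff_right inner_commute
            algebra_simps)
    qed
    ultimately have "0 \<le> 2 * t * ((A *v u) \<bullet> (A *v g) - \<mu> * (u \<bullet> g)) + t\<^sup>2 * a"
      unfolding a_def by (simp add: algebra_simps)
    then show ?thesis
      using \<open>(A *v u) \<bullet> (A *v g) - \<mu> * (u \<bullet> g) = (norm g)\<^sup>2\<close>
      by (simp add: algebra_simps power2_eq_square)
  qed
  have "g = 0"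
  proof (rule ccontr)
    assume "g \<noteq> 0"
    then have n: "(norm g)\<^sup>2 > 0" by simp
    \<comment> \<open>A negative step small enough that \<open>t * a\<close> cannot cancel the
      first-order term; adding 1 avoids dividing by zero.\<close>
    define t where "t = - (norm g)\<^sup>2 / (\<bar>a\<bar> + 1)"
    have "t < 0" unfolding t_def using n by (intro divide_neg_pos) auto
    moreover have "\<bar>t * a\<bar> \<le> (norm g)\<^sup>2"
      unfolding t_def by (simp add: abs_mult field_simps)
    then have "2 * (norm g)\<^sup>2 + t * a > 0" using n by linarith
    ultimately show False using var[of t] by (simp add: zero_le_mult_iff)
  qed
  moreover have "A *v u \<noteq> 0"
  proof
    assume "A *v u = 0"
    moreover obtain z where "u = transpose A *v z" using u(1) unfolding S_def by auto
    ultimately show False using transpose_mult_eq_0_imp[of A z] u(2) by auto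
  qed
  ultimately show ?thesis
    using that[of u] u min unfolding S_def g_def \<mu>_def by auto
qed

text \<open>The value attained by the row-space minimizer is itself a nonzero singular value, so
  \<open>sigma_min\<close> is at most that value and inherits its lower bound.\<close>

lemma
  fixes A :: "real^'n^'m"
  assumes "A \<noteq> 0"
  shows sigma_min_pos: "0 < sigma_min A"
    and sigma_min_le_row_space:
      "v \<in> range ((*v) (transpose A)) \<Longrightarrow> sigma_min A * norm v \<le> norm (A *v v)"
proof -
  obtain u where u: "u \<in> range ((*v) (transpose A))" "norm u = 1" "A *v u \<noteq> 0"
    "(transpose A ** A) *v u = (norm (A *v u))\<^sup>2 *\<^sub>R u"
    "\<And>v. v \<in> range ((*v) (transpose A)) \<Longrightarrow> norm (A *v u) * norm v \<le> norm (A *v v)"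
    using row_space_minimizer[OF assms] by metis
  have "finite {s. singular_value A s \<and> s \<noteq> 0}"
    by (rule finite_subset[OF _ finite_singular_values[of A]]) auto
  moreover have "norm (A *v u) \<in> {s. singular_value A s \<and> s \<noteq> 0}"
    using u(2-4) unfolding singular_value_def by (auto intro!: exI[of _ u])
  ultimately have "sigma_min A \<in> {s. singular_value A s \<and> s \<noteq> 0}"
    and le: "sigma_min A \<le> norm (A *v u)"
    unfolding sigma_min_def by (metis Min_in empty_iff, metis Min_le)
  then show "0 < sigma_min A" by (auto simp: singular_value_def)
  show "sigma_min A * norm v \<le> norm (A *v v)" if "v \<in> range ((*v) (transpose A))"
    using u(5)[OF that] mult_right_mono[OF le, of "norm v"] by simp
qed

text \<open>Duality: for the preimage \<open>w\<close> of \<open>y\<close> in the row space, the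
  squared norm of \<open>y\<close> equals \<open>w \<bullet> (transpose A *v y)\<close>. Apply
  Cauchy-Schwarz, bound \<open>w\<close> by the row-space estimate and cancel \<open>norm w\<close>;
  if \<open>w\<close> is 0, so is \<open>y\<close>.\<close>

lemma sigma_min_le_column_space:
  fixes A :: "real^'n^'m"
  assumes "A \<noteq> 0" and "y \<in> range ((*v) A)"
  shows "sigma_min A * norm y \<le> norm (transpose A *v y)"
proof -
  define w where "w = pseudoinverse A *v y"
  have w: "w \<in> range ((*v) (transpose A))"
    unfolding w_def by (rule pseudoinverse_in_row_space)
  have "A ** pseudoinverse A ** A = A"
    using is_pseudoinverse_pseudoinverse[of A] unfolding is_pseudoinverse_def by auto
  then have Aw: "A *v w = y"
    using assms(2) unfolding w_def by (auto simp: matrix_vector_mul_assoc)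
  have "sigma_min A * norm w * norm y \<le> norm y * norm y"
    using sigma_min_le_row_space[OF assms(1) w] by (intro mult_right_mono) (auto simp: Aw)
  also have "norm y * norm y = w \<bullet> (transpose A *v y)"
    by (metis Aw inner_matrix_vector_mult_left power2_norm_eq_inner power2_eq_square)
  also have "\<dots> \<le> norm w * norm (transpose A *v y)"
    by (rule norm_cauchy_schwarz)
  finally have "norm w * (sigma_min A * norm y) \<le> norm w * norm (transpose A *v y)"
    by (simp add: ac_simps)
  then show ?thesis
    using Aw by (cases "w = 0") auto
qed

section \<open>Matrix norms and the averaged decrease in one step\<close>

lemma frobenius_norm_power2:
  fixes A :: "real^'n^'m"
  shows "(frobenius_norm A)\<^sup>2 = (\<Sum>i\<in>UNIV. (norm (row i A))\<^sup>2)"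
  unfolding frobenius_norm_def power2_norm_eq_inner
  by (simp add: sum_nonneg inner_vec_def row_def power2_eq_square)

lemma frobenius_norm_pos:
  fixes A :: "real^'n^'m"
  assumes "A \<noteq> 0"
  shows "0 < (frobenius_norm A)\<^sup>2"
proof -
  obtain i where "row i A \<noteq> 0"
    using assms by (auto simp: vec_eq_iff row_def)
  then show ?thesis
    unfolding frobenius_norm_power2 by (intro sum_pos2[of _ i]) auto
qed

lemma norm_le_spectral_norm:
  fixes A :: "real^'n^'m"
  shows "norm (A *v v) \<le> spectral_norm A * norm v"
  unfolding spectral_norm_def by (rule onorm) (rule matrix_vector_mul_bounded_linear)

lemma spectral_norm_pos:
  fixes A :: "real^'n^'m"
  assumes "A \<noteq> 0"
  shows "0 < spectral_norm A"
proof -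
  obtain v where "A *v v \<noteq> 0" using assms by (metis matrix_eq matrix_vector_mult_0)
  then have "0 < spectral_norm A * norm v"
    using norm_le_spectral_norm[of A v] by (smt (verit) zero_less_norm_iff)
  then show ?thesis by (simp add: zero_less_mult_iff)
qed

lemma norm_power2_matrix_vector_mult_rows:
  fixes A :: "real^'n^'m"
  shows "(norm (A *v v))\<^sup>2 = (\<Sum>i\<in>UNIV. (row i A \<bullet> v)\<^sup>2)"
  unfolding power2_norm_eq_inner
  by (simp add: inner_vec_def matrix_mult_dot row_def power2_eq_square)

text \<open>Pythagoras; for \<open>u = 0\<close>, division by zero gives 0 and both sides reduce to
  the squared norm of \<open>y\<close>.\<close>

lemma norm_power2_minus_projection:
  fixes u y :: "'a::real_inner"
  shows "(norm (y - ((u \<bullet> y) / (norm u)\<^sup>2) *\<^sub>R u))\<^sup>2 = (norm y)\<^sup>2 - (u \<bullet> y)\<^sup>2 / (norm u)\<^sup>2"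
proof (cases "u = 0")
  case False
  then have "u \<bullet> u \<noteq> 0" by simp
  then show ?thesis
    unfolding power2_norm_eq_inner
    by (simp add: inner_diff_left inner_diff_right inner_commute
        power2_eq_square field_simps)
qed simp

text \<open>The sampling weight of a row offsets the denominator of its decrease, because the norm
  of \<open>A *v row i A\<close> is controlled by that of the row. What remains sums over the rows
  to the squared norm of \<open>A *v z\<close>.\<close>

lemma rkas_step_contraction:
  fixes A :: "real^'n^'m"
  assumes A: "A \<noteq> 0" and y: "y \<in> range ((*v) A)"
  shows "(\<Sum>i\<in>UNIV. (norm (row i A))\<^sup>2 / (frobenius_norm A)\<^sup>2 *
           (norm (y - rkas_stepsize A i y *\<^sub>R (A *v row i A)))\<^sup>2)
    \<le> (1 - sigma_min A ^ 4 / ((spectral_norm A)\<^sup>2 * (frobenius_norm A)\<^sup>2)) * (norm y)\<^sup>2"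
proof -
  define F where "F = (frobenius_norm A)\<^sup>2"
  define L where "L = (spectral_norm A)\<^sup>2"
  define \<sigma> where "\<sigma> = sigma_min A"
  define z where "z = transpose A *v y"
  have F: "F > 0" unfolding F_def using frobenius_norm_pos[OF A] .
  have L: "L > 0" unfolding L_def using spectral_norm_pos[OF A] by simp
  have \<sigma>: "\<sigma> > 0" unfolding \<sigma>_def using sigma_min_pos[OF A] .
  \<comment> \<open>Weighting by the squared row norm covers zero rows as well: both sides are then
    0.\<close>
  have term_bound: "(norm (row i A))\<^sup>2 * (norm (y - rkas_stepsize A i y *\<^sub>R (A *v row i A)))\<^sup>2
      \<le> (norm (row i A))\<^sup>2 * (norm y)\<^sup>2 - (row i A \<bullet> z)\<^sup>2 / L" for i
  proof (cases "row i A = 0")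
    case False
    define u where "u = A *v row i A"
    \<comment> \<open>Entry \<open>i\<close> of \<open>u\<close> is the squared norm of the row, so
      \<open>u\<close> cannot vanish.\<close>
    have "u \<bullet> axis i 1 = row i A \<bullet> row i A"
      unfolding u_def by (simp add: inner_axis matrix_mult_dot row_def)
    then have "u \<noteq> 0" using False by auto
    have "(norm u)\<^sup>2 \<le> L * (norm (row i A))\<^sup>2"
      unfolding u_def L_def power_mult_distrib[symmetric]
      by (intro power_mono norm_le_spectral_norm) auto
    then have "(row i A \<bullet> z)\<^sup>2 / L \<le> (norm (row i A))\<^sup>2 * ((row i A \<bullet> z)\<^sup>2 / (norm u)\<^sup>2)"
      using L \<open>u \<noteq> 0\<close> mult_left_mono[of "(norm u)\<^sup>2" "L * (norm (row i A))\<^sup>2" "(row i A \<bullet> z)\<^sup>2"]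
      by (simp add: field_simps)
    moreover have "u \<bullet> y = row i A \<bullet> z"
      unfolding u_def z_def by (rule inner_matrix_vector_mult_left)
    ultimately show ?thesis
      unfolding rkas_stepsize_def u_def[symmetric] norm_power2_minus_projection
      by (simp add: right_diff_distrib)
  qed simp
  \<comment> \<open>One factor \<sigma> comes from the column-space bound and one from the row-space
    bound; squaring gives the fourth power.\<close>
  have "\<sigma>\<^sup>2 * norm y \<le> \<sigma> * norm z"
    using sigma_min_le_column_space[OF A y] \<sigma>
    unfolding z_def \<sigma>_def by (simp add: power2_eq_square mult.assoc)
  also have "\<dots> \<le> norm (A *v z)"
    unfolding \<sigma>_def using sigma_min_le_row_space[OF A] z_def by blast
  finally have "(\<sigma>\<^sup>2 * norm y)\<^sup>2 \<le> (norm (A *v z))\<^sup>2"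
    by (intro power_mono) auto
  then have Az: "\<sigma> ^ 4 * (norm y)\<^sup>2 \<le> (norm (A *v z))\<^sup>2"
    by (simp add: power_mult_distrib)
  have "(\<Sum>i\<in>UNIV. (norm (row i A))\<^sup>2 / F * (norm (y - rkas_stepsize A i y *\<^sub>R (A *v row i A)))\<^sup>2)
      = (\<Sum>i\<in>UNIV. (norm (row i A))\<^sup>2 * (norm (y - rkas_stepsize A i y *\<^sub>R (A *v row i A)))\<^sup>2) / F"
    by (simp add: sum_divide_distrib)
  also have "\<dots> \<le> (\<Sum>i\<in>UNIV. (norm (row i A))\<^sup>2 * (norm y)\<^sup>2 - (row i A \<bullet> z)\<^sup>2 / L) / F"
    using F by (intro divide_right_mono sum_mono term_bound) auto
  also have "\<dots> = (F * (norm y)\<^sup>2 - (norm (A *v z))\<^sup>2 / L) / F"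
    unfolding F_def frobenius_norm_power2 norm_power2_matrix_vector_mult_rows
    by (simp add: sum_subtractf sum_distrib_right sum_divide_distrib)
  also have "\<dots> \<le> (F * (norm y)\<^sup>2 - \<sigma> ^ 4 * (norm y)\<^sup>2 / L) / F"
    using F L Az by (intro divide_right_mono diff_left_mono) auto
  also have "\<dots> = (1 - \<sigma> ^ 4 / (L * F)) * (norm y)\<^sup>2"
    using F L by (simp add: field_simps)
  finally show ?thesis unfolding F_def L_def \<sigma>_def .
qed

text \<open>The step bound, applied to a nonzero \<open>A *v v\<close>, puts a sum of nonnegative
  terms below the factor times a positive number.\<close>

lemma rkas_factor_nonneg:
  fixes A :: "real^'n^'m"
  assumes "A \<noteq> 0"
  shows "0 \<le> 1 - sigma_min A ^ 4 / ((spectral_norm A)\<^sup>2 * (frobenius_norm A)\<^sup>2)"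
    (is "0 \<le> ?c")
proof -
  obtain v where v: "A *v v \<noteq> 0" using assms by (metis matrix_eq matrix_vector_mult_0)
  have "0 \<le> (\<Sum>i\<in>UNIV. (norm (row i A))\<^sup>2 / (frobenius_norm A)\<^sup>2 *
           (norm (A *v v - rkas_stepsize A i (A *v v) *\<^sub>R (A *v row i A)))\<^sup>2)"
    by (intro sum_nonneg) auto
  also have "\<dots> \<le> ?c * (norm (A *v v))\<^sup>2"
    by (rule rkas_step_contraction[OF assms]) auto
  finally show ?thesis using v by (simp add: zero_le_mult_iff)
qed

section \<open>Expected decay of a potential along a recursion driven by independent indices\<close>

text \<open>The state at time \<open>k\<close> is a function of the earlier indices alone, hence
  independent of index \<open>k\<close>. Splitting over the finitely many values of that index then
  does the work of a conditional expectation.\<close>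

lemma (in prob_space) expectation_iterate_contraction:
  fixes X :: "nat \<Rightarrow> 'a \<Rightarrow> 'i::finite" and y :: "(nat \<Rightarrow> 'i) \<Rightarrow> nat \<Rightarrow> 's" and V :: "'s \<Rightarrow> real"
  assumes indep: "indep_vars (\<lambda>_. count_space UNIV) X UNIV"
    and p: "\<And>j i. \<P>(\<omega> in M. X j \<omega> = i) = p i"
    and y_0: "\<And>s. y s 0 = y0"
    and y_Suc: "\<And>s k. y s (Suc k) = step (s k) (y s k)"
    and I_0: "I y0" and I_step: "\<And>i z. I z \<Longrightarrow> I (step i z)"
    and contr: "\<And>z. I z \<Longrightarrow> (\<Sum>i\<in>UNIV. p i * V (step i z)) \<le> c * V z"
    and c: "0 \<le> c"
  shows "integrable M (\<lambda>\<omega>. V (y (\<lambda>j. X j \<omega>) k))"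
    and "expectation (\<lambda>\<omega>. V (y (\<lambda>j. X j \<omega>) k)) \<le> c ^ k * V y0"
proof -
  define Y where "Y k \<omega> = y (\<lambda>j. X j \<omega>) k" for k \<omega>
  \<comment> \<open>State \<open>k\<close> reads only the indices below \<open>k\<close>, so
    \<open>n = k\<close> is allowed.\<close>
  have y_restrict: "y (restrict s {..<n}) k = y s k" if "k \<le> n" for s k n
    using that by (induction k) (auto simp: y_0 y_Suc)
  have meas_X [measurable]: "X j \<in> M \<rightarrow>\<^sub>M count_space UNIV" for j
    using indep unfolding indep_vars_def by auto
  \<comment> \<open>With the discrete sigma-algebra on states every function of the state is
    measurable, so \<open>step\<close> and \<open>V\<close> may be arbitrary; the index type is
    finite, which permits treating \<open>step\<close> one index at a time.\<close>
  have y_meas: "(\<lambda>s. y s k) \<in> PiM {..<n} (\<lambda>_. count_space UNIV) \<rightarrow>\<^sub>M count_space UNIV"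
    if "k \<le> n" for k n
    using that
  proof (induction k)
    case (Suc k)
    have ys: "(\<lambda>s. y s k) \<in> PiM {..<n} (\<lambda>_. count_space UNIV) \<rightarrow>\<^sub>M count_space UNIV"
      using Suc by simp
    have "(\<lambda>s. s k) \<in> PiM {..<n} (\<lambda>_. count_space UNIV) \<rightarrow>\<^sub>M count_space (UNIV :: 'i set)"
      using Suc.prems by (intro measurable_component_singleton) auto
    then have "(\<lambda>s. step (s k) (y s k)) \<in> PiM {..<n} (\<lambda>_. count_space UNIV) \<rightarrow>\<^sub>M count_space UNIV"
      by (rule measurable_compose_countable[rotated, where f = "\<lambda>i s. step i (y s k)"])
         (rule measurable_compose[OF ys], simp)
    then show ?case by (simp add: y_Suc)
  qed (simp add: y_0)
  \<comment> \<open>The disjoint blocks \<open>{..<k}\<close> and \<open>{k}\<close> of the index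
    sequence are independent, and the two sides are functions of one block each.\<close>
  have indepY: "indep_var borel (\<lambda>\<omega>. f (Y k \<omega>)) borel (\<lambda>\<omega>. g (X k \<omega>))"
    for f :: "'s \<Rightarrow> real" and g :: "'i \<Rightarrow> real" and k
  proof -
    have iv: "indep_var (PiM {..<k} (\<lambda>_. count_space UNIV)) (\<lambda>\<omega>. restrict (\<lambda>i. X i \<omega>) {..<k})
        (PiM {k} (\<lambda>_. count_space UNIV)) (\<lambda>\<omega>. restrict (\<lambda>i. X i \<omega>) {k})"
      by (rule indep_var_restrict[OF indep]) auto
    have f: "(\<lambda>s. f (y s k)) \<in> PiM {..<k} (\<lambda>_. count_space UNIV) \<rightarrow>\<^sub>M borel"
      by (rule measurable_compose[OF y_meas]) auto
    have g: "(\<lambda>s. g (s k)) \<in> PiM {k} (\<lambda>_. count_space UNIV) \<rightarrow>\<^sub>M borel"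
      by (rule measurable_compose[OF measurable_component_singleton]) auto
    from indep_var_compose[OF iv f g] show ?thesis
      by (simp add: comp_def y_restrict Y_def)
  qed
  have Y_meas: "Y k \<in> M \<rightarrow>\<^sub>M count_space UNIV" for k
  proof -
    have "(\<lambda>\<omega>. restrict (\<lambda>i. X i \<omega>) {..<k}) \<in> M \<rightarrow>\<^sub>M PiM {..<k} (\<lambda>_. count_space UNIV)"
      by (intro measurable_restrict meas_X)
    from measurable_compose[OF this y_meas[OF order.refl]] show ?thesis
      by (simp add: y_restrict Y_def[abs_def])
  qed
  \<comment> \<open>Only finitely many states are reachable at a fixed time, so any real function of
    the state is bounded and thus integrable.\<close>
  have fin: "finite (range (\<lambda>s. y s k))" for k
  proof (induction k)
    case (Suc k)
    have "range (\<lambda>s. y s (Suc k)) \<subseteq> (\<Union>i. step i ` range (\<lambda>s. y s k))"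
      by (auto simp: y_Suc)
    then show ?case by (rule finite_subset) (use Suc in auto)
  qed (simp add: y_0)
  have bdd: "integrable M (\<lambda>\<omega>. f (Y k \<omega>))" for f :: "'s \<Rightarrow> real" and k
  proof (rule integrable_const_bound)
    let ?B = "\<Sum>z\<in>range (\<lambda>s. y s k). \<bar>f z\<bar>"
    have "\<bar>f (Y k \<omega>)\<bar> \<le> ?B" for \<omega>
      unfolding Y_def by (rule member_le_sum) (use fin in auto)
    then show "AE \<omega> in M. norm (f (Y k \<omega>)) \<le> ?B" by simp
    show "(\<lambda>\<omega>. f (Y k \<omega>)) \<in> borel_measurable M"
      by (rule measurable_compose[OF Y_meas]) simp
  qed
  have inv: "I (y s k)" for s k
    by (induction k) (simp_all add: y_0 y_Suc I_0 I_step)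
  have ind: "expectation (\<lambda>\<omega>. indicator {i} (X k \<omega>)) = p i" for i k
  proof -
    have "expectation (\<lambda>\<omega>. indicator {i} (X k \<omega>))
        = expectation (indicator {\<omega> \<in> space M. X k \<omega> = i})"
      by (intro Bochner_Integration.integral_cong) (auto simp: indicator_def)
    also have "\<dots> = p i" using p by simp
    finally show ?thesis .
  qed
  have step: "expectation (\<lambda>\<omega>. V (Y (Suc k) \<omega>)) \<le> c * expectation (\<lambda>\<omega>. V (Y k \<omega>))" for k
  proof -
    have iv: "indep_var borel (\<lambda>\<omega>. V (step i (Y k \<omega>))) borel (\<lambda>\<omega>. indicator {i} (X k \<omega>) :: real)" for i
      by (rule indepY)
    have int_ind: "integrable M (\<lambda>\<omega>. indicator {i} (X k \<omega>) :: real)" for i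
      by (rule integrable_const_bound[where B=1]) (auto simp: indicator_def)
    \<comment> \<open>Exactly one indicator is nonzero, and each summand is now a product of
      independent factors.\<close>
    have split: "V (Y (Suc k) \<omega>) = (\<Sum>i\<in>UNIV. V (step i (Y k \<omega>)) * indicator {i} (X k \<omega>))" for \<omega>
      by (simp add: Y_def y_Suc indicator_def if_distrib cong: if_cong)
    have "expectation (\<lambda>\<omega>. V (Y (Suc k) \<omega>))
        = (\<Sum>i\<in>UNIV. expectation (\<lambda>\<omega>. V (step i (Y k \<omega>)) * indicator {i} (X k \<omega>)))"
      unfolding split
      by (intro Bochner_Integration.integral_sum indep_var_integrable[OF iv bdd int_ind])
    also have "\<dots> = (\<Sum>i\<in>UNIV. expectation (\<lambda>\<omega>. V (step i (Y k \<omega>))) * p i)"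
      by (simp only: indep_var_lebesgue_integral[OF iv bdd int_ind] ind)
    also have "\<dots> = expectation (\<lambda>\<omega>. \<Sum>i\<in>UNIV. p i * V (step i (Y k \<omega>)))"
      by (simp add: bdd[of "\<lambda>z. V (step i z)" for i] mult.commute)
    also have "\<dots> \<le> expectation (\<lambda>\<omega>. c * V (Y k \<omega>))"
    proof (rule integral_mono)
      show "integrable M (\<lambda>\<omega>. \<Sum>i\<in>UNIV. p i * V (step i (Y k \<omega>)))"
        by (rule bdd[of "\<lambda>z. \<Sum>i\<in>UNIV. p i * V (step i z)"])
      show "integrable M (\<lambda>\<omega>. c * V (Y k \<omega>))"
        by (rule bdd[of "\<lambda>z. c * V z"])
    qed (simp add: Y_def contr inv)
    finally show ?thesis by simp
  qed
  show "integrable M (\<lambda>\<omega>. V (y (\<lambda>j. X j \<omega>) k))"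
    using bdd[of V k] by (simp add: Y_def)
  have "expectation (\<lambda>\<omega>. V (Y k \<omega>)) \<le> c ^ k * V y0"
  proof (induction k)
    case 0
    show ?case by (simp add: Y_def y_0 prob_space)
  next
    case (Suc k)
    then show ?case
      using step[of k] mult_left_mono[OF Suc c] by (simp add: mult.assoc)
  qed
  then show "expectation (\<lambda>\<omega>. V (y (\<lambda>j. X j \<omega>) k)) \<le> c ^ k * V y0"
    by (simp add: Y_def)
qed

section \<open>Mean-square convergence of the RKAS iterates\<close>

theorem corollary3p2:
  fixes A :: "real^'n^'m" and b :: "real^'m"
    and M :: "'w measure" and idx :: "nat \<Rightarrow> 'w \<Rightarrow> 'm" and k :: nat
  assumes "A \<noteq> 0"
    and "prob_space M"
    and "prob_space.indep_vars M (\<lambda>_. count_space UNIV) idx UNIV"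
    and "\<And>j i. \<P>(\<omega> in M. idx j \<omega> = i) = (norm (row i A))\<^sup>2 / (frobenius_norm A)\<^sup>2"
  shows "prob_space.expectation M
           (\<lambda>\<omega>. (norm (rkas_iterate A b (\<lambda>j. idx j \<omega>) k - pseudoinverse A *v b))\<^sup>2)
         \<le> sigma_min A powi (-2)
            * (1 - sigma_min A ^ 4 / ((spectral_norm A)\<^sup>2 * (frobenius_norm A)\<^sup>2)) ^ k
            * (norm (A *v 0 - A *v (pseudoinverse A *v b)))\<^sup>2"
proof -
  interpret prob_space M by fact
  define xs where "xs = pseudoinverse A *v b"
  define \<sigma> where "\<sigma> = sigma_min A"
  define c where "c = 1 - \<sigma> ^ 4 / ((spectral_norm A)\<^sup>2 * (frobenius_norm A)\<^sup>2)"
  define step where "step i z = (fst z - rkas_stepsize A i (snd z) *\<^sub>R row i A,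
      snd z - rkas_stepsize A i (snd z) *\<^sub>R (A *v row i A))" for i and z :: "(real^'n) \<times> (real^'m)"
  \<comment> \<open>The first conjunct ties the stepsize to the projected residual; the second keeps
    the error in the row space, where \<open>sigma_min\<close> bounds it.\<close>
  define I where "I z \<longleftrightarrow> snd z = A *v fst z - b \<and> fst z \<in> range ((*v) (transpose A))"
    for z :: "(real^'n) \<times> (real^'m)"
  define V where "V z = (norm (A *v fst z - A *v xs))\<^sup>2" for z :: "(real^'n) \<times> (real^'m)"
  have \<sigma>: "\<sigma> > 0" unfolding \<sigma>_def using sigma_min_pos[OF assms(1)] .
  have Suc: "rkas_state A b s (Suc k) = step (s k) (rkas_state A b s k)" for s k
    by (simp add: step_def Let_def case_prod_beta)
  have sub: "subspace (range ((*v) (transpose A)))"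
    by (rule subspace_range_matrix)
  have I0: "I (0, A *v 0 - b)" using sub by (simp add: I_def subspace_0)
  have Istep: "I (step i z)" if "I z" for i z
  proof -
    \<comment> \<open>Every update direction thus lies in the row space.\<close>
    have "row i A = transpose A *v axis i 1"
      by (simp add: vec_eq_iff row_def matrix_vector_mult_def transpose_def axis_def if_distrib
          cong: if_cong)
    then have "row i A \<in> range ((*v) (transpose A))" by simp
    then show ?thesis
      using that sub unfolding I_def step_def
      by (auto simp: matrix_vector_mult_diff_distrib matrix_vector_mult_scaleR
          intro!: subspace_diff subspace_scale)
  qed
  have contr: "(\<Sum>i\<in>UNIV. (norm (row i A))\<^sup>2 / (frobenius_norm A)\<^sup>2 * V (step i z)) \<le> c * V z"
    if "I z" for z
  proof -
    define y where "y = A *v fst z - A *v xs"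
    have y: "y = A *v (fst z - xs)" by (simp add: y_def matrix_vector_mult_diff_distrib)
    \<comment> \<open>The second summand is orthogonal to the column space, so it drops out of the
      numerator of the stepsize.\<close>
    have "snd z = y + (A *v xs - b)" using that by (simp add: I_def y_def)
    then have "rkas_stepsize A i (snd z) = rkas_stepsize A i y" for i
      unfolding rkas_stepsize_def xs_def
      by (simp add: inner_add_right pseudoinverse_residual_orthogonal)
    then have "V (step i z) = (norm (y - rkas_stepsize A i y *\<^sub>R (A *v row i A)))\<^sup>2" for i
      by (simp add: V_def step_def y_def matrix_vector_mult_diff_distrib matrix_vector_mult_scaleR
          algebra_simps)
    then show ?thesis
      using rkas_step_contraction[OF assms(1), of y] y
      by (simp add: V_def y_def[symmetric] c_def \<sigma>_def)
  qed
  have c0: "0 \<le> c" unfolding c_def \<sigma>_def using rkas_factor_nonneg[OF assms(1)] .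
  let ?z = "\<lambda>\<omega>. rkas_state A b (\<lambda>j. idx j \<omega>) k"
  note E = expectation_iterate_contraction[where y = "rkas_state A b" and X = idx and I = I and V = V
      and step = step and c = c and k = k, OF assms(3,4) rkas_state.simps(1) Suc I0 Istep contr c0]
  have "expectation (\<lambda>\<omega>. (norm (rkas_iterate A b (\<lambda>j. idx j \<omega>) k - xs))\<^sup>2)
      \<le> expectation (\<lambda>\<omega>. V (?z \<omega>) / \<sigma>\<^sup>2)"
  \<comment> \<open>This rule asks for integrability of the dominating nonnegative function
    only.\<close>
  proof (rule integral_mono')
    show "integrable M (\<lambda>\<omega>. V (?z \<omega>) / \<sigma>\<^sup>2)" using E(1) by simp
    fix \<omega>
    show "0 \<le> V (?z \<omega>) / \<sigma>\<^sup>2" by (simp add: V_def)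
    have "I (rkas_state A b s k)" for s k
      by (induction k) (use I0 Istep Suc in auto)
    then have "fst (?z \<omega>) - xs \<in> range ((*v) (transpose A))"
      using subspace_diff[OF sub] pseudoinverse_in_row_space unfolding I_def xs_def by blast
    then have "(\<sigma> * norm (fst (?z \<omega>) - xs))\<^sup>2 \<le> (norm (A *v (fst (?z \<omega>) - xs)))\<^sup>2"
      using \<sigma> unfolding \<sigma>_def by (intro power_mono sigma_min_le_row_space[OF assms(1)]) auto
    then show "(norm (rkas_iterate A b (\<lambda>j. idx j \<omega>) k - xs))\<^sup>2 \<le> V (?z \<omega>) / \<sigma>\<^sup>2"
      using \<sigma> by (simp add: V_def rkas_iterate_def matrix_vector_mult_diff_distrib
          power_mult_distrib field_simps)
  qed
  also have "\<dots> = expectation (\<lambda>\<omega>. V (?z \<omega>)) / \<sigma>\<^sup>2" by simp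
  also have "\<dots> \<le> c ^ k * V (0, A *v 0 - b) / \<sigma>\<^sup>2"
    using E(2) by (intro divide_right_mono) auto
  also have "\<dots> = \<sigma> powi (-2) * c ^ k * (norm (A *v 0 - A *v xs))\<^sup>2"
    by (simp add: V_def power_int_minus divide_inverse ac_simps)
  finally show ?thesis unfolding c_def \<sigma>_def xs_def .
qed

end
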